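(* Let $w\in\mathrm{flat}(\mathcal{Q}_n)$, let $\pi=\pi_0\,|\,\pi_1\,|\,\cdots\,|\,\pi_k\in\Pi^B_{n-1}$ be the type $B$ set partition corresponding to $w$ under the bijection $\varphi:\Pi^B_{n-1}\to\mathrm{flat}(\mathcal{Q}_n)$ (that is, $\varphi(\pi)=w$), and write $\pi_i=N_iP_i$ for all $0\leq i\leq k$. Then \[1+|\{N_i : |N_i|\geq 1\}|+|\{P_i : |P_i|\geq 2\}|\] is the number of runs in $w$.
   Context: A Stirling permutation of order $N$ is a word $w=w_1w_2\cdots w_{2N}$ in which every letter of $\{1,\dots,N\}$ appears exactly twice and such that, for each $i$, every letter appearing between the two occurrences of $i$ is greater than $i$. $\mathcal{Q}_N$ is the set of Stirling permutations of order $N$. The runs of $w\in\mathcal{Q}_N$ are its maximal contiguous weakly increasing subwords. $w$ is flattened if the sequence of leading (first) terms of its runs, read from left to right, is weakly increasing. $\mathrm{flat}(\mathcal{Q}_N)$ is the set of flattened elements of $\mathcal{Q}_N$. $[-M,M]$ denotes the set of integers from $-M$ to $M$. A type $B$ set partition of $[-M,M]$ is a collection $\mathcal{B}$ of pairwise disjoint subsets (blocks) of $[-M,M]$ whose union is $[-M,M]$, such that (i) if $\beta\in\mathcal{B}$ then $-\beta:=\{-b: b\in\beta\}\in\mathcal{B}$, and (ii) there is exactly one block $\beta\in\mathcal{B}$ with $\beta=-\beta$ (the zero-block, which contains $0$). For any other block $\beta$, the blocks $\beta,-\beta$ form a block pair. $\Pi^B_M$ is the set of all type $B$ set partitions of $[-M,M]$.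 Each $\mathcal{B}\in\Pi^B_M$ with $k$ block pairs is written canonically as $\pi=\pi_0|\pi_1|\cdots|\pi_k$: from each block pair keep only the block $\beta$ in which the element of smallest absolute value is positive; $\pi_0$ is the zero-block with its negative elements removed; $\pi_1,\dots,\pi_k$ are the kept blocks, ordered by increasing minimum positive element. Within each block the negative elements are listed first in decreasing order, followed by the nonnegative elements in increasing order. Write $\pi_i=N_iP_i$, where $N_i$ is the set of negative elements of $\pi_i$ and $P_i$ the set of its nonnegative elements (so $N_0=\emptyset$). For a finite set $S$ of integers let $h(S)=\{|s|+1: s\in S\}$ (with $h(\emptyset)=\emptyset$). For a finite set $S=\{s_1<s_2<\cdots<s_r\}$ of positive integers let $f(S)$ be the word $s_1s_1s_2s_2\cdots s_rs_r$ and $g(S)$ the word $s_1s_2s_2s_3s_3\cdots s_rs_rs_1$ (so $g(\{s_1\})=s_1s_1$), with $f(\emptyset)=g(\emptyset)$ the empty word. The bijection $\varphi:\Pi^B_M\to\mathrm{flat}(\mathcal{Q}_{M+1})$ is given by the concatenation \[\varphi(\pi)=g(h(P_0))\,f(h(N_1))\,g(h(P_1))\cdots f(h(N_k))\,g(h(P_k)).\] *)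

theory Defs
  imports "HOL-Library.Disjoint_Sets"
begin

section \<open>Flattened Stirling permutations\<close>

definition stirling_perms :: "nat \<Rightarrow> nat list set" where
  "stirling_perms N = {w. length w = 2 * N \<and> (\<forall>i\<in>{1..N}. count_list w i = 2) \<and>
     (\<forall>a b c. a < b \<and> b < c \<and> c < length w \<and> w ! a = w ! c \<longrightarrow> w ! a < w ! b)}"

text \<open>The contiguous subword occupying the positions \<open>i, \<dots>, j - 1\<close>.\<close>

definition subword :: "nat list \<Rightarrow> nat \<Rightarrow> nat \<Rightarrow> nat list" where
  "subword w i j = take (j - i) (drop i w)"

definition increasing_subword :: "nat list \<Rightarrow> nat \<Rightarrow> nat \<Rightarrow> bool" where
  "increasing_subword w i j \<longleftrightarrow> i < j \<and> j \<le> length w \<and> sorted (subword w i j)"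

text \<open>A run is recorded by its position \<open>(i, j)\<close> in the word (see \<^const>\<open>subword\<close>), so that
  runs are counted by occurrence.\<close>

definition runs :: "nat list \<Rightarrow> (nat \<times> nat) set" where
  "runs w = {(i, j). increasing_subword w i j \<and>
     (\<forall>i' j'. i' \<le> i \<and> j \<le> j' \<and> increasing_subword w i' j' \<longrightarrow> i' = i \<and> j' = j)}"

definition leading_terms :: "nat list \<Rightarrow> nat list" where
  "leading_terms w = map (\<lambda>i. w ! i) (sorted_list_of_set (fst ` runs w))"

definition flattened :: "nat list \<Rightarrow> bool" where
  "flattened w \<longleftrightarrow> sorted (leading_terms w)"

definition flat_stirling_perms :: "nat \<Rightarrow> nat list set" where
  "flat_stirling_perms N = {w \<in> stirling_perms N. flattened w}"

section \<open>Type \<open>B\<close> set partitions\<close>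

definition type_B_partitions :: "nat \<Rightarrow> int set set set" where
  "type_B_partitions M = {B. partition_on {- int M..int M} B \<and>
     (\<forall>\<beta>\<in>B. uminus ` \<beta> \<in> B) \<and> (\<exists>!\<beta>. \<beta> \<in> B \<and> \<beta> = uminus ` \<beta>)}"

definition zero_block :: "int set set \<Rightarrow> int set" where
  "zero_block B = (THE \<beta>. \<beta> \<in> B \<and> \<beta> = uminus ` \<beta>)"

definition neg_part :: "int set \<Rightarrow> int set" where
  "neg_part \<beta> = {b \<in> \<beta>. b < 0}"

definition nonneg_part :: "int set \<Rightarrow> int set" where
  "nonneg_part \<beta> = {b \<in> \<beta>. 0 \<le> b}"

text \<open>The chosen representatives of the block pairs. In a block different from the zero-block
  the element of smallest absolute value is unique, as such a block is disjoint from its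
  negative.\<close>

definition kept_blocks :: "int set set \<Rightarrow> int set set" where
  "kept_blocks B = {\<beta> \<in> B. \<beta> \<noteq> uminus ` \<beta> \<and> (\<exists>b\<in>\<beta>. 0 < b \<and> (\<forall>c\<in>\<beta>. \<bar>b\<bar> \<le> \<bar>c\<bar>))}"

text \<open>The canonical form \<open>\<pi>\<^sub>0|\<pi>\<^sub>1|\<dots>|\<pi>\<^sub>k\<close>, as a list of blocks.
  The prescribed order of the elements inside a block is not recorded:
  only the sets \<open>N\<^sub>i\<close> and \<open>P\<^sub>i\<close>, i.e. \<open>neg_part\<close> and \<open>nonneg_part\<close> of \<open>\<pi>\<^sub>i\<close>, are ever used.\<close>

definition canonical_blocks :: "int set set \<Rightarrow> int set list" where
  "canonical_blocks B = nonneg_part (zero_block B) #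
     sorted_key_list_of_set (\<lambda>\<beta>. Min {b \<in> \<beta>. 0 < b}) (kept_blocks B)"

section \<open>The bijection \<open>\<phi>\<close>\<close>

definition abs_succ :: "int set \<Rightarrow> nat set" where
  "abs_succ S = (\<lambda>s. nat \<bar>s\<bar> + 1) ` S"

definition doubled :: "nat list \<Rightarrow> nat list" where
  "doubled xs = concat (map (\<lambda>s. [s, s]) xs)"

definition f_word :: "nat set \<Rightarrow> nat list" where
  "f_word S = doubled (sorted_list_of_set S)"

definition g_word :: "nat set \<Rightarrow> nat list" where
  "g_word S = (case sorted_list_of_set S of [] \<Rightarrow> [] | s # ss \<Rightarrow> s # doubled ss @ [s])"

text \<open>The zero-block contributes only a \<open>g_word\<close> factor, since \<open>N\<^sub>0\<close> is empty and \<open>f_word\<close> of the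
  empty set is the empty word.\<close>

definition phi :: "int set set \<Rightarrow> nat list" where
  "phi B = concat (map (\<lambda>\<beta>. f_word (abs_succ (neg_part \<beta>)) @ g_word (abs_succ (nonneg_part \<beta>)))
     (canonical_blocks B))"

end

theory Submission
  imports Defs
begin

text \<open>
  The runs of a nonempty word are separated by its descents, the positions whose letter is larger
  than the next one, so the word has one more run than it has descents. It remains to locate the
  descents of \<open>\<phi>(\<pi>) = g(h(P\<^sub>0)) f(h(N\<^sub>1)) g(h(P\<^sub>1)) \<dots> f(h(N\<^sub>k)) g(h(P\<^sub>k))\<close>.

  Inside the factors: \<open>f(S)\<close> is weakly increasing, and \<open>g(S)\<close> is weakly increasing except that its
  last letter, the minimum of \<open>S\<close>, repeats its first one; the step to that letter is a descent
  exactly when \<open>S\<close> has at least two elements.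

  Between factors: in a kept block the element of smallest absolute value is positive, and its
  negative is not in the block, as the block is disjoint from its negative. Hence every letter of
  \<open>f(h(N\<^sub>i))\<close> exceeds the first letter \<open>min h(P\<^sub>i)\<close> of \<open>g(h(P\<^sub>i))\<close>, which gives a descent
  whenever \<open>N\<^sub>i\<close> is nonempty. The word of the block \<open>\<pi>\<^sub>i\<close> thus starts with a letter that is at least
  \<open>min h(P\<^sub>i)\<close>, and it ends with \<open>min h(P\<^sub>i)\<close>. As these minima increase with \<open>i\<close>, no descent arises
  where one block gives way to the next.

  So the descents correspond to the indices \<open>i\<close> with \<open>N\<^sub>i\<close> nonempty together with the indices with
  \<open>|P\<^sub>i| \<ge> 2\<close>. Counting the sets \<open>N\<^sub>i\<close> and \<open>P\<^sub>i\<close> in place of their indices changes nothing, since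
  distinct blocks are disjoint and these sets are nonempty.
\<close>

section \<open>Runs and descents of a word\<close>

fun descents :: "nat list \<Rightarrow> nat" where
  "descents (x # y # zs) = of_bool (y < x) + descents (y # zs)"
| "descents _ = 0"

lemma descents_append:
  assumes "xs \<noteq> []" and "ys \<noteq> []"
  shows "descents (xs @ ys) = descents xs + of_bool (hd ys < last xs) + descents ys"
  using assms
proof (induction xs rule: descents.induct)
  case ("2_2" x)
  then show ?case by (cases ys) auto
qed auto

lemma descents_sorted: "sorted xs \<Longrightarrow> descents xs = 0"
  by (induction xs rule: descents.induct) auto

lemma descents_concat:
  assumes "\<And>x. x \<in> set xs \<Longrightarrow> u x \<noteq> []"
    and "sorted_wrt (\<lambda>x y. last (u x) \<le> hd (u y)) xs"
  shows "descents (concat (map u xs)) = (\<Sum>x\<leftarrow>xs. descents (u x))"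
  using assms
proof (induction xs)
  case (Cons x xs)
  show ?case
  proof (cases xs)
    case (Cons y ys)
    with Cons.prems have "concat (map u xs) \<noteq> []"
      and "\<not> hd (concat (map u xs)) < last (u x)" by auto
    with Cons.prems Cons.IH show ?thesis
      by (simp add: descents_append)
  qed simp
qed simp

lemma card_descent_positions: "card {i. Suc i < length w \<and> w ! Suc i < w ! i} = descents w"
proof (induction w rule: descents.induct)
  case (1 x y zs)
  let ?D = "\<lambda>w. {i. Suc i < length w \<and> w ! Suc i < w ! i}"
  have split: "?D (x # y # zs) = (if y < x then {0} else {}) \<union> Suc ` ?D (y # zs)"
  proof (rule set_eqI)
    fix i
    show "i \<in> ?D (x # y # zs) \<longleftrightarrow> i \<in> (if y < x then {0} else {}) \<union> Suc ` ?D (y # zs)"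
      by (cases i) auto
  qed
  have fin: "finite (?D (y # zs))"
    by (rule finite_subset[of _ "{..<length (y # zs)}"]) auto
  have "card (?D (x # y # zs)) = card (if y < x then {0::nat} else {}) + card (Suc ` ?D (y # zs))"
    unfolding split by (rule card_Un_disjoint) (use fin in auto)
  also have "card (Suc ` ?D (y # zs)) = card (?D (y # zs))"
    by (rule card_image) simp
  finally show ?case using 1 by simp
qed simp_all

lemma increasing_subword_iff:
  "increasing_subword w i j \<longleftrightarrow>
    i < j \<and> j \<le> length w \<and> (\<forall>a. i \<le> a \<and> Suc a < j \<longrightarrow> w ! a \<le> w ! Suc a)"
proof (cases "i < j \<and> j \<le> length w")
  case True
  then have len: "length (subword w i j) = j - i"
    and nth: "\<And>b. b < j - i \<Longrightarrow> subword w i j ! b = w ! (i + b)"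
    by (auto simp: subword_def)
  have "sorted (subword w i j) \<longleftrightarrow> (\<forall>b. Suc b < j - i \<longrightarrow> w ! (i + b) \<le> w ! Suc (i + b))"
    unfolding sorted_iff_nth_Suc len by (auto simp: nth)
  also have "\<dots> \<longleftrightarrow> (\<forall>a. i \<le> a \<and> Suc a < j \<longrightarrow> w ! a \<le> w ! Suc a)"
  proof safe
    fix a assume *: "\<forall>b. Suc b < j - i \<longrightarrow> w ! (i + b) \<le> w ! Suc (i + b)" "i \<le> a" "Suc a < j"
    then show "w ! a \<le> w ! Suc a" using *(1)[rule_format, of "a - i"] by auto
  qed auto
  finally show ?thesis using True by (simp add: increasing_subword_def)
qed (auto simp: increasing_subword_def)

text \<open>A run can be extended to the left unless it starts the word or follows a descent; conversely
  the longest increasing subword from such a position is a run.\<close>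

lemma run_starts: "fst ` runs w = {i. i < length w \<and> (i = 0 \<or> w ! i < w ! (i - 1))}"
proof (rule set_eqI, rule iffI)
  fix i assume "i \<in> fst ` runs w"
  then obtain j where inc: "increasing_subword w i j"
    and max: "\<And>i' j'. i' \<le> i \<Longrightarrow> j \<le> j' \<Longrightarrow> increasing_subword w i' j' \<Longrightarrow> i' = i \<and> j' = j"
    by (auto simp: runs_def)
  have "w ! i < w ! (i - 1)" if "i \<noteq> 0"
  proof (rule ccontr)
    assume "\<not> w ! i < w ! (i - 1)"
    with that have step: "w ! (i - 1) \<le> w ! Suc (i - 1)" by simp
    have "w ! a \<le> w ! Suc a" if "i - 1 \<le> a" "Suc a < j" for a
    proof (cases "a = i - 1")
      case False
      with that have "i \<le> a" by simp
      then show ?thesis using that inc by (auto simp: increasing_subword_iff)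
    qed (use step in simp)
    with inc have "increasing_subword w (i - 1) j"
      by (auto simp: increasing_subword_iff)
    from max[OF _ _ this] that show False by simp
  qed
  with inc show "i \<in> {i. i < length w \<and> (i = 0 \<or> w ! i < w ! (i - 1))}"
    by (auto simp: increasing_subword_iff)
next
  fix i assume "i \<in> {i. i < length w \<and> (i = 0 \<or> w ! i < w ! (i - 1))}"
  then have i: "i < length w" "i = 0 \<or> w ! i < w ! (i - 1)" by auto
  define J where "J = {j. increasing_subword w i j}"
  have J: "finite J" "J \<noteq> {}"
  proof -
    show "finite J"
      by (rule finite_subset[of _ "{..length w}"]) (auto simp: J_def increasing_subword_iff)
    have "Suc i \<in> J" using i by (auto simp: J_def increasing_subword_iff)
    then show "J \<noteq> {}" by auto
  qed
  have inc: "increasing_subword w i (Max J)"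
    using Max_in[OF J] by (simp add: J_def)
  have "i' = i \<and> j' = Max J"
    if "i' \<le> i" "Max J \<le> j'" and inc': "increasing_subword w i' j'" for i' j'
  proof -
    have "i' = i"
    proof (rule ccontr)
      assume "i' \<noteq> i"
      with \<open>i' \<le> i\<close> have "i' \<le> i - 1" by simp
      moreover have "Suc (i - 1) < j'"
        using that(2) inc \<open>i' \<noteq> i\<close> \<open>i' \<le> i\<close> by (auto simp: increasing_subword_iff)
      ultimately have "w ! (i - 1) \<le> w ! Suc (i - 1)"
        using inc' unfolding increasing_subword_iff by blast
      with \<open>i' \<noteq> i\<close> \<open>i' \<le> i\<close> i show False by simp
    qed
    moreover from this inc' have "j' \<in> J" by (simp add: J_def)
    ultimately show ?thesis using Max_ge[OF J(1)] that(2) by fastforce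
  qed
  with inc have "(i, Max J) \<in> runs w" by (auto simp: runs_def)
  then show "i \<in> fst ` runs w" by force
qed

lemma inj_on_fst_runs: "inj_on fst (runs w)"
proof (rule inj_onI, clarsimp)
  fix i j j' assume *: "(i, j) \<in> runs w" "(i, j') \<in> runs w"
  then have inc: "increasing_subword w i j" "increasing_subword w i j'"
    by (simp_all add: runs_def)
  have "j' = j" if "j \<le> j'"
    using *(1) that inc(2) unfolding runs_def by blast
  moreover have "j = j'" if "j' \<le> j"
    using *(2) that inc(1) unfolding runs_def by blast
  ultimately show "j = j'" using nat_le_linear by blast
qed

theorem card_runs:
  assumes "w \<noteq> []"
  shows "card (runs w) = Suc (descents w)"
proof -
  let ?D = "{i. Suc i < length w \<and> w ! Suc i < w ! i}"
  have "card (runs w) = card (fst ` runs w)"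
    by (rule card_image[OF inj_on_fst_runs, symmetric])
  also have "fst ` runs w = insert 0 (Suc ` ?D)"
  proof (rule set_eqI)
    fix i show "i \<in> fst ` runs w \<longleftrightarrow> i \<in> insert 0 (Suc ` ?D)"
      using assms by (cases i) (auto simp: run_starts)
  qed
  also have "card \<dots> = Suc (card (Suc ` ?D))"
  proof (rule card_insert_disjoint)
    have "finite ?D" by (rule finite_subset[of _ "{..<length w}"]) auto
    then show "finite (Suc ` ?D)" by simp
  qed auto
  also have "card (Suc ` ?D) = card ?D" by (rule card_image) simp
  finally show ?thesis by (simp add: card_descent_positions)
qed

section \<open>The words of the blocks\<close>

lemma set_doubled: "set (doubled xs) = set xs"
  by (auto simp: doubled_def)

lemma doubled_eq_Nil_iff: "doubled xs = [] \<longleftrightarrow> xs = []"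
  by (cases xs) (auto simp: doubled_def)

lemma sorted_doubled: "sorted xs \<Longrightarrow> sorted (doubled xs)"
  by (induction xs) (auto simp: doubled_def)

lemma f_word_properties:
  assumes "finite S"
  shows "set (f_word S) = S" and "f_word S = [] \<longleftrightarrow> S = {}" and "descents (f_word S) = 0"
  using assms by (simp_all add: f_word_def set_doubled doubled_eq_Nil_iff descents_sorted sorted_doubled)

text \<open>Without its last letter the word \<open>g(T)\<close> is weakly increasing, and that last letter \<open>min T\<close> lies
  strictly below its predecessor \<open>max T\<close> unless \<open>T\<close> is a singleton.\<close>

lemma g_word_properties:
  assumes "finite T" and "T \<noteq> {}"
  shows "g_word T \<noteq> []" and "hd (g_word T) = Min T" and "last (g_word T) = Min T"
    and "descents (g_word T) = of_bool (card T \<ge> 2)"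
proof -
  obtain ss where T: "sorted_list_of_set T = Min T # ss"
    using assms sorted_list_of_set_nonempty by blast
  then have g: "g_word T = (Min T # doubled ss) @ [Min T]" by (simp add: g_word_def)
  show "g_word T \<noteq> []" "hd (g_word T) = Min T" "last (g_word T) = Min T"
    by (simp_all add: g)
  have strict: "sorted_wrt (<) (Min T # ss)"
    using strict_sorted_list_of_set[of T] T by simp
  then have "sorted (Min T # ss)" by (rule strict_sorted_imp_sorted)
  then have sorted: "sorted (Min T # doubled ss)" by (auto simp: set_doubled sorted_doubled)
  have "card T = Suc (length ss)"
    using length_sorted_list_of_set[of T] T by simp
  moreover have "Min T < last (Min T # doubled ss) \<longleftrightarrow> ss \<noteq> []"
  proof (cases "ss = []")
    case False
    then have "last (doubled ss) \<in> set ss"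
      using last_in_set[of "doubled ss"] by (simp add: set_doubled doubled_eq_Nil_iff)
    with strict False show ?thesis by (simp add: doubled_eq_Nil_iff)
  qed (simp add: doubled_def)
  ultimately show "descents (g_word T) = of_bool (card T \<ge> 2)"
    unfolding g by (subst descents_append) (auto simp: descents_sorted[OF sorted] Suc_le_eq)
qed

text \<open>Here \<open>S\<close> and \<open>T\<close> play the roles of \<open>h(N\<^sub>i)\<close> and \<open>h(P\<^sub>i)\<close>. If \<open>S\<close> is nonempty, the step from
  the last letter of \<open>f(S)\<close> down to the first letter \<open>min T\<close> of \<open>g(T)\<close> is a descent.\<close>

lemma descents_block_word:
  assumes S: "finite S" and T: "finite T" "T \<noteq> {}" and less: "\<And>s. s \<in> S \<Longrightarrow> Min T < s"
  shows "descents (f_word S @ g_word T) = of_bool (S \<noteq> {}) + of_bool (card T \<ge> 2)"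
    and "Min T \<le> hd (f_word S @ g_word T)"
proof -
  note f = f_word_properties[OF S] and g = g_word_properties[OF T]
  have "Min T < hd (f_word S) \<and> Min T < last (f_word S)" if "S \<noteq> {}"
    using that less f(1,2) hd_in_set[of "f_word S"] last_in_set[of "f_word S"] by auto
  then show "descents (f_word S @ g_word T) = of_bool (S \<noteq> {}) + of_bool (card T \<ge> 2)"
    and "Min T \<le> hd (f_word S @ g_word T)"
    using f(2,3) g by (cases "S = {}"; simp add: descents_append hd_append)+
qed

lemma abs_succ_properties:
  assumes "finite S"
  shows "finite (abs_succ S)" and "abs_succ S = {} \<longleftrightarrow> S = {}"
  using assms by (simp_all add: abs_succ_def)

lemma card_abs_succ_nonneg_part: "card (abs_succ (nonneg_part \<beta>)) = card (nonneg_part \<beta>)"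
  unfolding abs_succ_def by (rule card_image) (auto simp: inj_on_def nonneg_part_def)

lemma Min_abs_succ_nonneg_part:
  assumes "finite \<beta>" and "nonneg_part \<beta> \<noteq> {}"
  shows "Min (abs_succ (nonneg_part \<beta>)) = nat (Min (nonneg_part \<beta>)) + 1"
proof -
  have "abs_succ (nonneg_part \<beta>) = (\<lambda>s. nat s + 1) ` nonneg_part \<beta>"
    unfolding abs_succ_def by (rule image_cong) (auto simp: nonneg_part_def)
  moreover have "mono (\<lambda>s. nat s + 1)" by (rule monoI) simp
  moreover have "finite (nonneg_part \<beta>)" using assms by (simp add: nonneg_part_def)
  ultimately show ?thesis using assms mono_Min_commute by metis
qed

section \<open>The canonical form of a type \<open>B\<close> partition\<close>

lemma (in linorder) sorted_key_list_of_set_inj_on: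
  assumes "inj_on f A" and "finite A"
  shows "set (sorted_key_list_of_set f A) = A"
    and "sorted_wrt (<) (map f (sorted_key_list_of_set f A))"
proof -
  interpret key: folding_insort_key "(\<le>)" "(<)" A f
    by unfold_locales (fact assms(1))
  show "set (sorted_key_list_of_set f A) = A"
    and "sorted_wrt (<) (map f (sorted_key_list_of_set f A))"
    using assms(2) by simp_all
qed

lemma type_B_partitionsD:
  assumes "B \<in> type_B_partitions M"
  shows "disjoint B" and "\<Union> B = {- int M..int M}" and "\<forall>\<beta>\<in>B. uminus ` \<beta> \<in> B"
    and "\<exists>!\<beta>. \<beta> \<in> B \<and> \<beta> = uminus ` \<beta>"
proof -
  from assms have *: "(\<Union> B = {- int M..int M} \<and> disjoint B \<and> {} \<notin> B) \<and>
      (\<forall>\<beta>\<in>B. uminus ` \<beta> \<in> B) \<and> (\<exists>!\<beta>. \<beta> \<in> B \<and> \<beta> = uminus ` \<beta>)"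
    unfolding type_B_partitions_def partition_on_def mem_Collect_eq .
  from * show "disjoint B" by (elim conjE)
  from * show "\<Union> B = {- int M..int M}" by (elim conjE)
  from * show "\<forall>\<beta>\<in>B. uminus ` \<beta> \<in> B" by (elim conjE)
  from * show "\<exists>!\<beta>. \<beta> \<in> B \<and> \<beta> = uminus ` \<beta>" by (elim conjE)
qed

lemma uminus_image_inter:
  assumes "B \<in> type_B_partitions M" and "\<beta> \<in> B" and "\<beta> \<noteq> uminus ` \<beta>"
  shows "\<beta> \<inter> uminus ` \<beta> = {}"
  using disjointD[OF _ assms(2) _ assms(3)] type_B_partitionsD(1,3)[OF assms(1)] assms(2) by blast

lemma zero_block_properties:
  assumes "B \<in> type_B_partitions M"
  shows "zero_block B \<in> B" and "zero_block B = uminus ` zero_block B" and "0 \<in> zero_block B"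
proof -
  note unique = type_B_partitionsD(4)[OF assms]
  have zero: "zero_block B \<in> B \<and> zero_block B = uminus ` zero_block B"
    unfolding zero_block_def by (rule theI'[OF unique])
  then show "zero_block B \<in> B" by (rule conjunct1)
  from zero show "zero_block B = uminus ` zero_block B" by (rule conjunct2)
  \<comment> \<open>The block of \<open>0\<close> meets its negative, so it is the zero-block.\<close>
  have "0 \<in> \<Union> B" unfolding type_B_partitionsD(2)[OF assms] by simp
  then obtain \<beta> where \<beta>: "\<beta> \<in> B" "0 \<in> \<beta>" by (rule UnionE)
  then have "0 \<in> \<beta> \<inter> uminus ` \<beta>" by force
  then have "\<beta> = uminus ` \<beta>" using uminus_image_inter[OF assms \<beta>(1)] by blast
  with \<beta>(1) have "\<beta> \<in> B \<and> \<beta> = uminus ` \<beta>" by (rule conjI)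
  then have "zero_block B = \<beta>" unfolding zero_block_def by (rule the1_equality[OF unique])
  then show "0 \<in> zero_block B" using \<beta>(2) by simp
qed

lemma kept_block_properties:
  assumes B: "B \<in> type_B_partitions M" and \<beta>: "\<beta> \<in> kept_blocks B"
  shows "\<beta> \<in> B" and "finite \<beta>" and "\<beta> \<inter> zero_block B = {}"
    and "nonneg_part \<beta> = {b \<in> \<beta>. 0 < b}" and "nonneg_part \<beta> \<noteq> {}"
    and "\<And>c. c \<in> neg_part \<beta> \<Longrightarrow> Min (nonneg_part \<beta>) < - c"
proof -
  have nonsym: "\<beta> \<noteq> uminus ` \<beta>" and "\<beta> \<in> B" using \<beta> by (auto simp: kept_blocks_def)
  then show "\<beta> \<in> B" by simp
  note part = type_B_partitionsD(1,2)[OF B]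
  have "\<beta> \<subseteq> {- int M..int M}" using part(2) \<open>\<beta> \<in> B\<close> by blast
  then show fin: "finite \<beta>" by (rule finite_subset) simp
  have "\<beta> \<noteq> zero_block B" using nonsym zero_block_properties(2)[OF B] by blast
  then show inter: "\<beta> \<inter> zero_block B = {}"
    using part(1) \<open>\<beta> \<in> B\<close> zero_block_properties(1)[OF B] by (auto simp: disjoint_def)
  then have "0 \<notin> \<beta>" using zero_block_properties(3)[OF B] by auto
  then show "nonneg_part \<beta> = {b \<in> \<beta>. 0 < b}"
    by (auto simp: nonneg_part_def order_le_less)
  have "\<exists>b\<in>\<beta>. 0 < b \<and> (\<forall>c\<in>\<beta>. \<bar>b\<bar> \<le> \<bar>c\<bar>)"
    using \<beta> by (simp add: kept_blocks_def)
  then obtain b where b: "b \<in> \<beta>" "0 < b" "\<And>c. c \<in> \<beta> \<Longrightarrow> \<bar>b\<bar> \<le> \<bar>c\<bar>" by blast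
  then have b_nonneg: "b \<in> nonneg_part \<beta>" by (simp add: nonneg_part_def)
  then show "nonneg_part \<beta> \<noteq> {}" by auto
  fix c assume "c \<in> neg_part \<beta>"
  then have c: "c \<in> \<beta>" "c < 0" by (auto simp: neg_part_def)
  have "- c \<in> uminus ` \<beta>" using c(1) by (rule imageI)
  then have "b \<noteq> - c" using uminus_image_inter[OF B \<open>\<beta> \<in> B\<close> nonsym] b(1) by blast
  then have "b < - c" using b(2) b(3)[OF c(1)] c(2) by simp
  moreover have "Min (nonneg_part \<beta>) \<le> b"
    using b_nonneg fin by (intro Min_le) (simp_all add: nonneg_part_def)
  ultimately show "Min (nonneg_part \<beta>) < - c" by simp
qed

text \<open>The first part yields the descents inside the word of a block, the second rules out descents
  between consecutive blocks and keeps the sets \<open>N\<^sub>i\<close> and \<open>P\<^sub>i\<close> apart. The zero-block without its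
  negative elements needs no separate treatment: it contains \<open>0\<close> and its negative part is empty.\<close>

lemma canonical_blocks_properties:
  assumes B: "B \<in> type_B_partitions M"
  shows "\<And>\<beta>. \<beta> \<in> set (canonical_blocks B) \<Longrightarrow> finite \<beta> \<and> nonneg_part \<beta> \<noteq> {} \<and>
      (\<forall>c\<in>neg_part \<beta>. Min (nonneg_part \<beta>) < - c)"
    and "sorted_wrt (\<lambda>\<beta> \<gamma>. \<beta> \<inter> \<gamma> = {} \<and> Min (nonneg_part \<beta>) < Min (nonneg_part \<gamma>))
      (canonical_blocks B)"
proof -
  let ?key = "\<lambda>\<beta>::int set. Min {b \<in> \<beta>. 0 < b}"
  let ?Z = "nonneg_part (zero_block B)"
  note part = type_B_partitionsD(1,2)[OF B]
  note kept = kept_block_properties[OF B]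
  have key_in: "?key \<beta> \<in> \<beta> \<and> 0 < ?key \<beta>" if "\<beta> \<in> kept_blocks B" for \<beta>
  proof -
    have "{b \<in> \<beta>. 0 < b} \<noteq> {}" using kept(4,5)[OF that] by simp
    moreover have "finite {b \<in> \<beta>. 0 < b}" using kept(2)[OF that] by simp
    ultimately have "?key \<beta> \<in> {b \<in> \<beta>. 0 < b}" by (intro Min_in)
    then show ?thesis by simp
  qed
  \<comment> \<open>Sorting by a key is meaningful because disjoint blocks have different minima.\<close>
  have inj: "inj_on ?key (kept_blocks B)"
  proof (rule inj_onI)
    fix \<beta> \<gamma> assume *: "\<beta> \<in> kept_blocks B" "\<gamma> \<in> kept_blocks B" "?key \<beta> = ?key \<gamma>"
    have "?key \<beta> \<in> \<beta>" using key_in[OF *(1)] by (rule conjunct1)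
    moreover have "?key \<beta> \<in> \<gamma>" unfolding *(3) using key_in[OF *(2)] by (rule conjunct1)
    ultimately have "\<beta> \<inter> \<gamma> \<noteq> {}" by blast
    then show "\<beta> = \<gamma>"
      using kept(1)[OF *(1)] kept(1)[OF *(2)] part(1) unfolding disjoint_def by blast
  qed
  let ?ks = "sorted_key_list_of_set ?key (kept_blocks B)"
  have "finite (kept_blocks B)"
  proof (rule finite_subset)
    show "kept_blocks B \<subseteq> Pow {- int M..int M}" using kept(1) part(2) by blast
  qed simp
  note ks = sorted_key_list_of_set_inj_on[OF inj this]
  have set_ks: "set ?ks = kept_blocks B" by (rule ks(1))
  have cb: "canonical_blocks B = ?Z # ?ks" by (simp add: canonical_blocks_def)
  have Z: "finite ?Z" "0 \<in> ?Z" "nonneg_part ?Z = ?Z" "neg_part ?Z = {}"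
  proof -
    have "zero_block B \<subseteq> {- int M..int M}"
      unfolding part(2)[symmetric] by (rule Union_upper[OF zero_block_properties(1)[OF B]])
    then have "?Z \<subseteq> {- int M..int M}" by (auto simp: nonneg_part_def)
    then show "finite ?Z" by (rule finite_subset) simp
  qed (use zero_block_properties(3)[OF B] in \<open>auto simp: nonneg_part_def neg_part_def\<close>)
  have Min_Z: "Min ?Z = 0"
    using Z by (intro Min_eqI) (auto simp: nonneg_part_def)
  show "finite \<beta> \<and> nonneg_part \<beta> \<noteq> {} \<and> (\<forall>c\<in>neg_part \<beta>. Min (nonneg_part \<beta>) < - c)"
    if "\<beta> \<in> set (canonical_blocks B)" for \<beta>
  proof (cases "\<beta> = ?Z")
    case True
    then show ?thesis using Z by auto
  next
    case False
    then have "\<beta> \<in> kept_blocks B" using that by (simp add: cb set_ks)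
    from kept(2,5,6)[OF this] show ?thesis by blast
  qed
  have "sorted_wrt (\<lambda>\<beta> \<gamma>. ?key \<beta> < ?key \<gamma>) ?ks"
    using ks(2) by (simp add: sorted_wrt_map)
  then have "sorted_wrt (\<lambda>\<beta> \<gamma>. \<beta> \<inter> \<gamma> = {} \<and> Min (nonneg_part \<beta>) < Min (nonneg_part \<gamma>)) ?ks"
  proof (rule sorted_wrt_mono_rel[rotated])
    fix \<beta> \<gamma> assume *: "\<beta> \<in> set ?ks" "\<gamma> \<in> set ?ks" "?key \<beta> < ?key \<gamma>"
    then have k: "\<beta> \<in> kept_blocks B" "\<gamma> \<in> kept_blocks B" by (simp_all add: set_ks)
    have "\<beta> \<noteq> \<gamma>" using *(3) by auto
    then have "\<beta> \<inter> \<gamma> = {}" using k[THEN kept(1)] part(1) unfolding disjoint_def by blast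
    with *(3) show "\<beta> \<inter> \<gamma> = {} \<and> Min (nonneg_part \<beta>) < Min (nonneg_part \<gamma>)"
      using k[THEN kept(4)] by simp
  qed
  moreover have "?Z \<inter> \<gamma> = {} \<and> Min (nonneg_part ?Z) < Min (nonneg_part \<gamma>)" if "\<gamma> \<in> set ?ks" for \<gamma>
  proof -
    have \<gamma>: "\<gamma> \<in> kept_blocks B" using that by (simp add: set_ks)
    have "?Z \<subseteq> zero_block B" by (auto simp: nonneg_part_def)
    then have "?Z \<inter> \<gamma> = {}" using kept(3)[OF \<gamma>] by blast
    then show ?thesis using key_in[OF \<gamma>] kept(4)[OF \<gamma>] Z(3) Min_Z by simp
  qed
  ultimately show "sorted_wrt (\<lambda>\<beta> \<gamma>. \<beta> \<inter> \<gamma> = {} \<and> Min (nonneg_part \<beta>) < Min (nonneg_part \<gamma>))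
      (canonical_blocks B)"
    unfolding cb by simp
qed

section \<open>The number of runs\<close>

lemma descents_phi:
  assumes B: "B \<in> type_B_partitions M"
  shows "phi B \<noteq> []"
    and "descents (phi B) = (\<Sum>\<beta>\<leftarrow>canonical_blocks B.
      of_bool (card (neg_part \<beta>) \<ge> 1) + of_bool (card (nonneg_part \<beta>) \<ge> 2))"
proof -
  define u where "u \<beta> = f_word (abs_succ (neg_part \<beta>)) @ g_word (abs_succ (nonneg_part \<beta>))"
    for \<beta> :: "int set"
  have phi: "phi B = concat (map u (canonical_blocks B))"
    unfolding phi_def u_def ..
  have u: "u \<beta> \<noteq> []" "last (u \<beta>) = nat (Min (nonneg_part \<beta>)) + 1"
    "nat (Min (nonneg_part \<beta>)) + 1 \<le> hd (u \<beta>)"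
    "descents (u \<beta>) = of_bool (card (neg_part \<beta>) \<ge> 1) + of_bool (card (nonneg_part \<beta>) \<ge> 2)"
    if "\<beta> \<in> set (canonical_blocks B)" for \<beta>
  proof -
    have \<beta>: "finite \<beta>" "nonneg_part \<beta> \<noteq> {}" "\<And>c. c \<in> neg_part \<beta> \<Longrightarrow> Min (nonneg_part \<beta>) < - c"
      using canonical_blocks_properties(1)[OF B that] by auto
    then have fin: "finite (neg_part \<beta>)" "finite (nonneg_part \<beta>)"
      by (simp_all add: neg_part_def nonneg_part_def)
    note S = abs_succ_properties[OF fin(1)] and T = abs_succ_properties[OF fin(2)]
    note Min_T = Min_abs_succ_nonneg_part[OF \<beta>(1,2)]
    have T_nonempty: "abs_succ (nonneg_part \<beta>) \<noteq> {}" using T(2) \<beta>(2) by simp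
    note g = g_word_properties[OF T(1) T_nonempty]
    have "Min (abs_succ (nonneg_part \<beta>)) < s" if "s \<in> abs_succ (neg_part \<beta>)" for s
      using that \<beta>(3) unfolding Min_T by (fastforce simp: abs_succ_def neg_part_def)
    note block = descents_block_word[OF S(1) T(1) T_nonempty this]
    show "u \<beta> \<noteq> []" "last (u \<beta>) = nat (Min (nonneg_part \<beta>)) + 1"
      using g by (simp_all add: u_def Min_T)
    show "nat (Min (nonneg_part \<beta>)) + 1 \<le> hd (u \<beta>)"
      using block(2) by (simp add: u_def Min_T)
    have "card (neg_part \<beta>) \<ge> 1 \<longleftrightarrow> neg_part \<beta> \<noteq> {}"
      using fin(1) by (simp add: Suc_le_eq card_gt_0_iff)
    then show "descents (u \<beta>) =
        of_bool (card (neg_part \<beta>) \<ge> 1) + of_bool (card (nonneg_part \<beta>) \<ge> 2)"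
      using block(1) S(2) by (simp add: u_def card_abs_succ_nonneg_part)
  qed
  show "phi B \<noteq> []" using u(1) by (simp add: phi canonical_blocks_def)
  have "sorted_wrt (\<lambda>\<beta> \<gamma>. last (u \<beta>) \<le> hd (u \<gamma>)) (canonical_blocks B)"
  proof (rule sorted_wrt_mono_rel[OF _ canonical_blocks_properties(2)[OF B]])
    fix \<beta> \<gamma> assume *: "\<beta> \<in> set (canonical_blocks B)" "\<gamma> \<in> set (canonical_blocks B)"
      "\<beta> \<inter> \<gamma> = {} \<and> Min (nonneg_part \<beta>) < Min (nonneg_part \<gamma>)"
    then have "nat (Min (nonneg_part \<beta>)) + 1 \<le> nat (Min (nonneg_part \<gamma>)) + 1"
      by (simp add: nat_mono)
    then show "last (u \<beta>) \<le> hd (u \<gamma>)" using u(2)[OF *(1)] u(3)[OF *(2)] by simp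
  qed
  then have "descents (phi B) = (\<Sum>\<beta>\<leftarrow>canonical_blocks B. descents (u \<beta>))"
    unfolding phi using u(1) by (intro descents_concat)
  also have "\<dots> = (\<Sum>\<beta>\<leftarrow>canonical_blocks B.
      of_bool (card (neg_part \<beta>) \<ge> 1) + of_bool (card (nonneg_part \<beta>) \<ge> 2))"
    using u(4) by (intro arg_cong[of _ _ sum_list] map_cong) auto
  finally show "descents (phi B) = (\<Sum>\<beta>\<leftarrow>canonical_blocks B.
      of_bool (card (neg_part \<beta>) \<ge> 1) + of_bool (card (nonneg_part \<beta>) \<ge> 2))" .
qed

text \<open>A nonempty set cannot be a part of two disjoint blocks, so different indices give different
  sets; the bound \<open>1 \<le> m\<close> keeps empty sets out of the count.\<close>

lemma card_parts_eq_count: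
  fixes F :: "nat \<Rightarrow> 'a set"
  assumes disj: "sorted_wrt (\<lambda>\<beta> \<gamma>. \<beta> \<inter> \<gamma> = {}) bs"
    and F: "\<And>i. i < length bs \<Longrightarrow> F i = part (bs ! i)"
    and part: "\<And>\<beta>. part \<beta> \<subseteq> \<beta>" and "1 \<le> m"
  shows "card {F i | i. i < length bs \<and> card (F i) \<ge> m} = (\<Sum>\<beta>\<leftarrow>bs. of_bool (card (part \<beta>) \<ge> m))"
proof -
  let ?I = "{i. i < length bs \<and> card (F i) \<ge> m}"
  have ne: "F i \<noteq> F j" if "i < j" "j < length bs" "card (F j) \<ge> m" for i j
  proof
    assume "F i = F j"
    then have "F j \<subseteq> bs ! i \<inter> bs ! j" using that F part by (metis Int_greatest order.strict_trans)
    moreover have "bs ! i \<inter> bs ! j = {}" using disj that by (simp add: sorted_wrt_iff_nth_less)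
    ultimately have "F j = {}" by blast
    with that(3) \<open>1 \<le> m\<close> show False by simp
  qed
  have "inj_on F ?I"
  proof (rule inj_onI)
    fix i j assume "i \<in> ?I" "j \<in> ?I" "F i = F j"
    then show "i = j" using ne[of i j] ne[of j i] by (cases i j rule: linorder_cases) auto
  qed
  then have "card (F ` ?I) = card ?I" by (rule card_image)
  also have "card ?I = card {i \<in> {..<length bs}. card (part (bs ! i)) \<ge> m}"
    using F by (intro arg_cong[of _ _ card]) auto
  also have "\<dots> = (\<Sum>i<length bs. of_bool (card (part (bs ! i)) \<ge> m))"
    by (simp add: sum.If_cases of_bool_def Int_def)
  also have "\<dots> = (\<Sum>\<beta>\<leftarrow>bs. of_bool (card (part \<beta>) \<ge> m))"
    by (simp add: sum_list_sum_nth atLeast0LessThan)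
  finally show ?thesis by (simp add: setcompr_eq_image)
qed

theorem lemma4p1:
  fixes n k :: nat and w :: "nat list" and B :: "int set set"
    and \<pi> :: "int set list" and N P :: "nat \<Rightarrow> int set"
  assumes "n \<ge> 1"
    and "w \<in> flat_stirling_perms n"
    and "B \<in> type_B_partitions (n - 1)"
    and "phi B = w"
    and "canonical_blocks B = \<pi>" and "length \<pi> = k + 1"
    and "\<And>i. i \<le> k \<Longrightarrow> N i = neg_part (\<pi> ! i)"
    and "\<And>i. i \<le> k \<Longrightarrow> P i = nonneg_part (\<pi> ! i)"
  shows "1 + card {N i | i. i \<le> k \<and> card (N i) \<ge> 1} + card {P i | i. i \<le> k \<and> card (P i) \<ge> 2}
    = card (runs w)"
proof -
  note \<pi> = assms(5)
  have len: "i < length \<pi> \<longleftrightarrow> i \<le> k" for i using assms(6) by auto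
  have disj: "sorted_wrt (\<lambda>\<beta> \<gamma>. \<beta> \<inter> \<gamma> = {}) \<pi>"
    using canonical_blocks_properties(2)[OF assms(3)] unfolding \<pi>
    by (rule sorted_wrt_mono_rel[rotated]) simp
  have "card {N i | i. i \<le> k \<and> card (N i) \<ge> 1} = (\<Sum>\<beta>\<leftarrow>\<pi>. of_bool (card (neg_part \<beta>) \<ge> 1))"
    using card_parts_eq_count[OF disj, of N neg_part 1] assms(7)
    by (simp add: len) (simp add: neg_part_def)
  moreover have "card {P i | i. i \<le> k \<and> card (P i) \<ge> 2} = (\<Sum>\<beta>\<leftarrow>\<pi>. of_bool (card (nonneg_part \<beta>) \<ge> 2))"
    using card_parts_eq_count[OF disj, of P nonneg_part 2] assms(8)
    by (simp add: len) (simp add: nonneg_part_def)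
  moreover have "card (runs w) = Suc (descents w)"
    using card_runs descents_phi(1)[OF assms(3)] assms(4) by simp
  ultimately show ?thesis
    using descents_phi(2)[OF assms(3)] by (simp add: \<pi> assms(4) sum_list_addf)
qed

end
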